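(* Assume that $\Phi\in L^1(\mu)$ and $\Phi(u)=0$ for $\mu$-a.e. $u$ in the interval $(0,1)$. If the integral operator $\mathbb{K}_{\Phi,\mu}$ is bounded in $L^2(\mathbb{R})$, then $\mathbb{H}_{\Phi,\mu}$ is bounded in $PW$.
   Context: $\mu$ is a regular positive Borel measure on $(0,\infty)$ and $\Phi:(0,\infty)\to\mathbb{C}$ is $\mu$-measurable. The Hausdorff operator is $(\mathbb{H}_{\Phi,\mu}F)(z)=\int_0^\infty \Phi(u)F(z/u)\,d\mu(u)$, $z\in\mathbb{C}$. $PW=PW_\pi$ is the space of entire functions of exponential type (at most) $\pi$ whose restrictions to $\mathbb{R}$ belong to $L^2(\mathbb{R})$, with the $L^2(\mathbb{R})$ norm. $\mathbb{K}_{\Phi,\mu}$ is the integral operator $(\mathbb{K}_{\Phi,\mu}f)(t)=\int_{-\infty}^\infty K_{\Phi,\mu}(t,x)f(x)\,dx$ with kernel $K_{\Phi,\mu}(t,x)=\int_0^\infty\Phi(u)\,\mathrm{sinc}\left(\frac tu-x\right)d\mu(u)$, $t,x\in\mathbb{R}$, where $\mathrm{sinc}(z)=\frac{\sin(\pi z)}{\pi z}$, $\mathrm{sinc}(0)=1$. *)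

theory Defs
  imports "HOL-Complex_Analysis.Complex_Analysis"
begin

text \<open>Regularity means that every Borel subset of \<open>X\<close> is both outer and inner regular.
  Finiteness on compact sets is not required. On a locally compact, sigma-compact space
  such as the open half-line, Radon measures are a special case.\<close>

definition regular_borel_measure_on :: "'a::t2_space set \<Rightarrow> 'a measure \<Rightarrow> bool" where
  "regular_borel_measure_on X \<mu> \<longleftrightarrow>
     sets \<mu> = sets (restrict_space borel X) \<and>
     (\<forall>A\<in>sets \<mu>. emeasure \<mu> A = (INF U\<in>{U. openin (top_of_set X) U \<and> A \<subseteq> U}. emeasure \<mu> U)) \<and>
     (\<forall>A\<in>sets \<mu>. emeasure \<mu> A = (SUP K\<in>{K. compact K \<and> K \<subseteq> A}. emeasure \<mu> K))"

definition L2 :: "(real \<Rightarrow> complex) set" where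
  "L2 = {f. f \<in> borel_measurable lebesgue \<and> integrable lebesgue (\<lambda>x. (norm (f x))\<^sup>2)}"

definition L2_norm :: "(real \<Rightarrow> complex) \<Rightarrow> real" where
  "L2_norm f = sqrt (LINT x|lebesgue. (norm (f x))\<^sup>2)"

definition exponential_type_le :: "(complex \<Rightarrow> complex) \<Rightarrow> real \<Rightarrow> bool" where
  "exponential_type_le F \<sigma> \<longleftrightarrow>
     (\<forall>\<epsilon>>0. \<exists>A. \<forall>z. norm (F z) \<le> A * exp ((\<sigma> + \<epsilon>) * norm z))"

definition paley_wiener :: "real \<Rightarrow> (complex \<Rightarrow> complex) set" where
  "paley_wiener \<sigma> = {F. F holomorphic_on UNIV \<and> exponential_type_le F \<sigma> \<and>
                         (\<lambda>t. F (complex_of_real t)) \<in> L2}"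

definition PW_norm :: "(complex \<Rightarrow> complex) \<Rightarrow> real" where
  "PW_norm F = L2_norm (\<lambda>t. F (complex_of_real t))"

text \<open>The function \<open>\<Phi>\<close> is only measurable for the completion of \<open>\<mu>\<close>,
  so all integrals are taken with respect to the completed measure.\<close>

definition hausdorff_integrand ::
    "(real \<Rightarrow> complex) \<Rightarrow> (complex \<Rightarrow> complex) \<Rightarrow> complex \<Rightarrow> real \<Rightarrow> complex" where
  "hausdorff_integrand \<Phi> F z u = \<Phi> u * F (z / complex_of_real u)"

definition hausdorff_operator ::
    "(real \<Rightarrow> complex) \<Rightarrow> real measure \<Rightarrow> (complex \<Rightarrow> complex) \<Rightarrow> complex \<Rightarrow> complex" where
  "hausdorff_operator \<Phi> \<mu> F z = (LINT u|completion \<mu>. hausdorff_integrand \<Phi> F z u)"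

definition normalized_sinc :: "complex \<Rightarrow> complex" where
  "normalized_sinc z = (if z = 0 then 1 else sin (of_real pi * z) / (of_real pi * z))"

definition hausdorff_kernel ::
    "(real \<Rightarrow> complex) \<Rightarrow> real measure \<Rightarrow> real \<Rightarrow> real \<Rightarrow> complex" where
  "hausdorff_kernel \<Phi> \<mu> t x =
     (LINT u|completion \<mu>. \<Phi> u * normalized_sinc (complex_of_real (t / u - x)))"

definition integral_operator ::
    "(real \<Rightarrow> real \<Rightarrow> complex) \<Rightarrow> (real \<Rightarrow> complex) \<Rightarrow> real \<Rightarrow> complex" where
  "integral_operator K f t = (LINT x|lebesgue. K t x * f x)"

definition bounded_operator_in ::
    "('a \<Rightarrow> 'b) set \<Rightarrow> (('a \<Rightarrow> 'b) \<Rightarrow> real) \<Rightarrow> (('a \<Rightarrow> 'b) \<Rightarrow> 'a \<Rightarrow> 'b) \<Rightarrow> bool" where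
  "bounded_operator_in V nrm T \<longleftrightarrow>
     (\<forall>f\<in>V. T f \<in> V) \<and> (\<exists>C. \<forall>f\<in>V. nrm (T f) \<le> C * nrm f)"

text \<open>The Bochner integral of a non-integrable function is 0, so absolute convergence of the
  defining integral at every point is required explicitly.\<close>

definition hausdorff_bounded_in_PW :: "(real \<Rightarrow> complex) \<Rightarrow> real measure \<Rightarrow> bool" where
  "hausdorff_bounded_in_PW \<Phi> \<mu> \<longleftrightarrow>
     (\<forall>F\<in>paley_wiener pi. \<forall>z. integrable (completion \<mu>) (hausdorff_integrand \<Phi> F z)) \<and>
     bounded_operator_in (paley_wiener pi) PW_norm (hausdorff_operator \<Phi> \<mu>)"

text \<open>No convergence condition is needed here when \<open>\<Phi>\<close> is integrable: the normalized
  sinc has norm 1 in \<open>L2\<close>, so by Minkowski each \<open>hausdorff_kernel \<Phi> \<mu> t\<close> has \<open>L2\<close> norm at most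
  the \<open>L1\<close> norm of \<open>\<Phi>\<close>, and its product with any \<open>L2\<close> function is integrable.\<close>

definition kernel_operator_bounded_in_L2 :: "(real \<Rightarrow> complex) \<Rightarrow> real measure \<Rightarrow> bool" where
  "kernel_operator_bounded_in_L2 \<Phi> \<mu> \<longleftrightarrow>
     bounded_operator_in L2 L2_norm (integral_operator (hausdorff_kernel \<Phi> \<mu>))"

end

theory Submission
  imports Defs "HOL-Probability.Sinc_Integral" "HOL-Real_Asymp.Real_Asymp"
begin

text \<open>On the real axis the Hausdorff operator \<open>H\<close> agrees with the integral operator \<open>K\<close>: every
\<open>F\<close> in the Paley-Wiener space satisfies \<open>F w = \<integral> F x * sinc (w - x) dx\<close> for real \<open>w\<close>, and inserting
this at \<open>w = t / u\<close> and exchanging the integrals turns \<open>H F\<close> into \<open>K F\<close>. Boundedness of \<open>K\<close> on \<open>L2\<close>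
therefore gives the norm estimate and the square-integrability of \<open>H F\<close>. That \<open>H F\<close> is entire of
exponential type at most \<open>\<pi>\<close> comes from the support condition: for \<open>u \<ge> 1\<close> the dilation \<open>F (z / u)\<close>
grows no faster than \<open>F\<close>, uniformly in \<open>u\<close>. This is \<open>holomorphic_dilation_average\<close> and
\<open>exponential_type_dilation_average\<close>; the exchange is \<open>dilation_average_eq_integral_operator\<close>.

The main work is the reproducing formula \<open>paley_wiener_reproducing_formula\<close>, for functions that
are given by a growth condition and not as Fourier transforms. It is proved by complex
analysis. A Phragmen-Lindelof argument shows that an entire function of exponential type that is
bounded on the real axis is bounded by a constant times \<open>exp (\<sigma> \<bar>Im z\<bar>)\<close>
(\<open>phragmen_lindelof_exponential_type\<close>); square-integrability gives the boundedness on the real axis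
(\<open>entire_L2_bounded_on_reals\<close>). Then the integral of \<open>F x * sin (\<sigma> x) / (\<pi> x)\<close>, with \<open>\<sigma>\<close> larger than the
type of \<open>F\<close>, is evaluated by moving the two exponentials in the sine into the half-planes where they
decay, and finally \<open>\<sigma>\<close> decreases to the type.\<close>

section \<open>Phragmen-Lindelof bounds\<close>

text \<open>The cube of the square root is the power \<open>w\<^bsup>3/2\<^esup>\<close>. On the sector \<open>\<bar>arg w\<bar> \<le> \<pi>/4\<close> its argument
stays within \<open>3\<pi>/8\<close>, so its real part grows like \<open>\<bar>w\<bar>\<^bsup>3/2\<^esup>\<close>: faster than any linear function,
which is what a comparison function for exponential type must do.\<close>

lemma Re_csqrt_cubed_ge:
  assumes "\<bar>Im w\<bar> \<le> Re w"
  shows "Re (csqrt w ^ 3) \<ge> norm w * sqrt (norm w) / 32"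
proof -
  define a b where "a = Re (csqrt w)" and "b = Im (csqrt w)"
  have s: "csqrt w = Complex a b"
    by (simp add: a_def b_def del: csqrt.simps)
  have w: "w = Complex (a\<^sup>2 - b\<^sup>2) (2 * a * b)"
    using power2_csqrt[of w] unfolding s by (simp add: power2_eq_square complex_eq_iff)
  have a: "a \<ge> 0"
    using csqrt_principal[of w] by (auto simp: a_def)
  have "2 * (a * \<bar>b\<bar>) \<le> a\<^sup>2 - b\<^sup>2"
    using assms a by (simp add: w abs_mult)
  then have "2 * \<bar>b\<bar> * a + b\<^sup>2 \<le> a * a"
    by (simp add: power2_eq_square algebra_simps)
  then have "2 * \<bar>b\<bar> * a \<le> a * a" "a = 0 \<Longrightarrow> b = 0"
    using zero_le_power2[of b] by (linarith, simp)
  then have "2 * \<bar>b\<bar> \<le> a"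
    using a by (cases "a = 0") auto
  then have "(2 * \<bar>b\<bar>)\<^sup>2 \<le> a\<^sup>2"
    by (intro power_mono) auto
  then have ba: "4 * b\<^sup>2 \<le> a\<^sup>2"
    by (simp add: power_mult_distrib)
  have "norm w = (norm (csqrt w))\<^sup>2"
    by (metis norm_power power2_csqrt)
  then have nw: "norm w = a\<^sup>2 + b\<^sup>2"
    by (simp add: s cmod_power2)
  have "sqrt (norm w) \<le> 2 * a"
  proof (rule real_le_lsqrt)
    have "(2 * a)\<^sup>2 = 4 * a\<^sup>2"
      by (simp add: power_mult_distrib)
    then show "norm w \<le> (2 * a)\<^sup>2"
      using ba nw zero_le_power2[of a] by linarith
  qed (use a in auto)
  moreover have "norm w \<le> 2 * a\<^sup>2"
    using ba nw zero_le_power2[of b] by linarith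
  ultimately have "norm w * sqrt (norm w) \<le> 2 * a\<^sup>2 * (2 * a)"
    using a by (intro mult_mono) auto
  moreover have "Re (csqrt w ^ 3) = a * (a\<^sup>2 - 3 * b\<^sup>2)"
    by (simp add: s power3_eq_cube power2_eq_square algebra_simps)
  moreover have "a * (a\<^sup>2 - 3 * b\<^sup>2) \<ge> a * (a\<^sup>2 / 4)"
    using ba a by (intro mult_left_mono) auto
  moreover have "a * (a\<^sup>2 / 4) \<ge> 2 * a\<^sup>2 * (2 * a) / 32"
    using a by (simp add: power2_eq_square)
  ultimately show ?thesis
    by linarith
qed

text \<open>Multiplying \<open>f\<close> by \<open>exp (-\<epsilon> (z + 1)\<^bsup>3/2\<^esup>)\<close> beats the growth \<open>exp (B \<bar>z\<bar>)\<close>, so the maximum modulus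
principle applies on the sector cut off at a large radius; then \<open>\<epsilon>\<close> tends to 0. The shift by 1
keeps the branch point of the root away from the sector.\<close>

lemma phragmen_lindelof_sector:
  fixes f :: "complex \<Rightarrow> complex"
  assumes hol: "f holomorphic_on UNIV"
    and growth: "\<And>z. norm (f z) \<le> M * exp (B * norm z)"
    and boundary: "\<And>z. \<bar>Im z\<bar> = Re z \<Longrightarrow> norm (f z) \<le> M"
    and z: "\<bar>Im z\<bar> \<le> Re z"
  shows "norm (f z) \<le> M"
proof -
  have M: "M \<ge> 0"
    using growth[of 0] by (metis exp_zero mult.right_neutral mult_zero_right norm_ge_zero norm_zero order_trans)
  define p where "p = (\<lambda>z. csqrt (z + 1) ^ 3)"
  have p_ge: "Re (p z) \<ge> norm z * sqrt (norm z) / 32" if "\<bar>Im z\<bar> \<le> Re z" for z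
  proof -
    have "norm z \<le> norm (z + 1)"
      using that by (simp add: norm_complex_def power_mono)
    then have "norm z * sqrt (norm z) \<le> norm (z + 1) * sqrt (norm (z + 1))"
      by (intro mult_mono) auto
    then show ?thesis
      using Re_csqrt_cubed_ge[of "z + 1"] that by (simp add: p_def)
  qed
  have bound: "norm (f z) * exp (- (e * Re (p z))) \<le> M" if e: "e > 0" for e
  proof -
    define g where "g = (\<lambda>z. f z * exp (- (of_real e * p z)))"
    have norm_g: "norm (g z) = norm (f z) * exp (- (e * Re (p z)))" for z
      by (simp add: g_def norm_mult)
    \<comment> \<open>from radius \<open>(32 \<bar>B\<bar> / e)\<^sup>2\<close> on, the lower bound for \<open>e * Re (p z)\<close> is at least \<open>B \<bar>z\<bar>\<close>\<close>
    define R where "R = max (norm z) ((32 * \<bar>B\<bar> / e)\<^sup>2)"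
    define S where "S = {z. \<bar>Im z\<bar> \<le> Re z} \<inter> cball 0 R"
    have "closed {z. \<bar>Im z\<bar> \<le> Re z}"
      by (intro closed_Collect_le continuous_intros)
    then have S: "closed S"
      by (auto simp: S_def)
    have holg: "g holomorphic_on S"
      unfolding g_def p_def
      by (intro holomorphic_intros holomorphic_on_subset[OF hol])
         (auto simp: S_def complex_nonpos_Reals_iff)
    have "norm (g z) \<le> M"
    proof (rule maximum_modulus_frontier[where f = g and S = S])
      show "g holomorphic_on interior S"
        using holg interior_subset holomorphic_on_subset by blast
      show "continuous_on (closure S) g"
        using holg S by (simp add: holomorphic_on_imp_continuous_on)
      show "bounded S"
        by (auto simp: S_def)
      show "z \<in> S"
        using z by (auto simp: S_def R_def)
      fix \<zeta> assume "\<zeta> \<in> frontier S"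
      then have \<zeta>: "\<zeta> \<in> S" "\<zeta> \<notin> interior S"
        using S by (auto simp: frontier_def)
      have p0: "Re (p \<zeta>) \<ge> norm \<zeta> * sqrt (norm \<zeta>) / 32"
        using \<zeta> p_ge by (auto simp: S_def)
      have "\<bar>Im \<zeta>\<bar> = Re \<zeta> \<or> norm \<zeta> = R"
      proof (rule ccontr)
        assume "\<not> ?thesis"
        with \<zeta> have "\<zeta> \<in> {z. \<bar>Im z\<bar> < Re z} \<inter> ball 0 R"
          by (auto simp: S_def)
        moreover have "open ({z. \<bar>Im z\<bar> < Re z} \<inter> ball 0 R)"
          by (intro open_Int open_Collect_less continuous_intros) auto
        moreover have "{z. \<bar>Im z\<bar> < Re z} \<inter> ball 0 R \<subseteq> S"
          by (auto simp: S_def)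
        ultimately show False
          using \<zeta> interior_maximal by blast
      qed
      then show "norm (g \<zeta>) \<le> M"
      proof
        assume "\<bar>Im \<zeta>\<bar> = Re \<zeta>"
        moreover have "Re (p \<zeta>) \<ge> 0"
          using p0 by (rule order_trans[rotated]) simp
        ultimately have "norm (f \<zeta>) * exp (- (e * Re (p \<zeta>))) \<le> M * 1"
          using boundary e M by (intro mult_mono) auto
        then show ?thesis
          by (simp add: norm_g)
      next
        assume R: "norm \<zeta> = R"
        have "sqrt R \<ge> sqrt ((32 * \<bar>B\<bar> / e)\<^sup>2)"
          by (intro real_sqrt_le_mono) (simp add: R_def)
        then have "32 * \<bar>B\<bar> / e \<le> sqrt R"
          using e by simp
        then have "B \<le> e * sqrt R / 32"
          using e by (simp add: field_simps)
        moreover have "R \<ge> 0"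
          by (simp add: R_def le_max_iff_disj)
        ultimately have "B * R \<le> e * sqrt R / 32 * R"
          by (intro mult_right_mono)
        also have "\<dots> = e * (R * sqrt R / 32)"
          by simp
        also have "\<dots> \<le> e * Re (p \<zeta>)"
          using p0 e R by (intro mult_left_mono) auto
        finally have "exp (B * norm \<zeta>) * exp (- (e * Re (p \<zeta>))) \<le> 1"
          by (simp add: R flip: exp_add)
        then have "M * (exp (B * norm \<zeta>) * exp (- (e * Re (p \<zeta>)))) \<le> M * 1"
          using M by (intro mult_left_mono)
        moreover have "norm (f \<zeta>) * exp (- (e * Re (p \<zeta>))) \<le> M * exp (B * norm \<zeta>) * exp (- (e * Re (p \<zeta>)))"
          by (intro mult_right_mono growth) auto
        ultimately show ?thesis
          unfolding norm_g mult.assoc by linarith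
      qed
    qed
    then show ?thesis
      by (simp add: norm_g)
  qed
  have "((\<lambda>e. norm (f z) * exp (- (e * Re (p z)))) \<longlongrightarrow> norm (f z) * exp (- (0 * Re (p z)))) (at_right 0)"
    by (intro tendsto_intros)
  moreover have "\<forall>\<^sub>F e in at_right 0. norm (f z) * exp (- (e * Re (p z))) \<le> M"
    using bound by (auto simp: eventually_at_right_less eventually_at_filter)
  ultimately show ?thesis
    by (intro tendsto_upperbound[of _ "norm (f z)" "at_right 0" M]) auto
qed

text \<open>The function \<open>F z * exp (\<i> \<sigma> z)\<close> is bounded on the real axis and, because the factor cancels the
growth there, also on the positive imaginary axis. Each of the two quadrants of the upper half-plane
is a rotated sector.\<close>

lemma phragmen_lindelof_upper_half_plane:
  fixes F :: "complex \<Rightarrow> complex"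
  assumes hol: "F holomorphic_on UNIV" and \<sigma>: "\<sigma> \<ge> 0"
    and growth: "\<And>z. norm (F z) \<le> M * exp (\<sigma> * norm z)"
    and on_reals: "\<And>x. norm (F (complex_of_real x)) \<le> M"
    and z: "Im z \<ge> 0"
  shows "norm (F z) \<le> M * exp (\<sigma> * Im z)"
proof -
  have M: "M \<ge> 0"
    using on_reals[of 0] norm_ge_zero order_trans by blast
  define f where "f = (\<lambda>z. F z * exp (\<i> * of_real \<sigma> * z))"
  have norm_f: "norm (f z) = norm (F z) * exp (- (\<sigma> * Im z))" for z
    by (simp add: f_def norm_mult)
  \<comment> \<open>multiplication by \<open>1 + \<i>\<close> or \<open>-1 + \<i>\<close> maps the sector onto the quadrant that contains \<open>z\<close>\<close>
  define \<omega> where "\<omega> = (if Re z \<ge> 0 then Complex 1 1 else Complex (-1) 1)"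
  have \<omega>: "\<omega> \<noteq> 0" "norm \<omega> \<le> 2"
    by (auto simp: \<omega>_def complex_eq_iff cmod_def real_le_lsqrt)
  have "norm (f (\<omega> * (z / \<omega>))) \<le> M"
  proof (rule phragmen_lindelof_sector[where f = "\<lambda>\<zeta>. f (\<omega> * \<zeta>)" and B = "4 * \<sigma>"])
    show "(\<lambda>\<zeta>. f (\<omega> * \<zeta>)) holomorphic_on UNIV"
      unfolding f_def
      by (intro holomorphic_intros holomorphic_on_compose_gen[OF _ hol, unfolded o_def]) auto
  next
    fix \<zeta>
    have n: "norm (\<omega> * \<zeta>) \<le> 2 * norm \<zeta>"
      using \<omega> by (simp add: norm_mult mult_right_mono)
    have "norm (f (\<omega> * \<zeta>)) \<le> M * exp (\<sigma> * norm (\<omega> * \<zeta>)) * exp (- (\<sigma> * Im (\<omega> * \<zeta>)))"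
      unfolding norm_f by (intro mult_right_mono growth) auto
    also have "\<dots> = M * exp (\<sigma> * norm (\<omega> * \<zeta>) - \<sigma> * Im (\<omega> * \<zeta>))"
      by (simp only: exp_diff exp_minus divide_inverse mult.assoc)
    also have "\<sigma> * norm (\<omega> * \<zeta>) - \<sigma> * Im (\<omega> * \<zeta>) = \<sigma> * (norm (\<omega> * \<zeta>) - Im (\<omega> * \<zeta>))"
      by (simp add: algebra_simps)
    also have "M * exp \<dots> \<le> M * exp (\<sigma> * (4 * norm \<zeta>))"
      using n abs_Im_le_cmod[of "\<omega> * \<zeta>"] M \<sigma> by (intro mult_left_mono exp_mono) (auto intro!: mult_left_mono)
    finally show "norm (f (\<omega> * \<zeta>)) \<le> M * exp (4 * \<sigma> * norm \<zeta>)"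
      by (simp add: mult_ac)
  next
    fix \<zeta> assume \<zeta>: "\<bar>Im \<zeta>\<bar> = Re \<zeta>"
    let ?z = "\<omega> * \<zeta>"
    have "Im ?z = 0 \<or> Re ?z = 0 \<and> Im ?z \<ge> 0"
      using \<zeta> by (auto simp: \<omega>_def)
    then show "norm (f ?z) \<le> M"
    proof
      assume "Im ?z = 0"
      then have "?z = of_real (Re ?z)"
        by (simp add: complex_eq_iff)
      then show ?thesis
        using on_reals[of "Re ?z"] \<open>Im ?z = 0\<close> by (simp add: norm_f)
    next
      assume *: "Re ?z = 0 \<and> Im ?z \<ge> 0"
      then have "norm ?z = Im ?z"
        by (simp add: cmod_eq_Im)
      then have "norm (F ?z) * exp (- (\<sigma> * Im ?z)) \<le> M * exp (\<sigma> * Im ?z) * exp (- (\<sigma> * Im ?z))"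
        using growth[of ?z] by (intro mult_right_mono) auto
      then show ?thesis
        by (simp add: norm_f mult.assoc flip: exp_add)
    qed
  next
    show "\<bar>Im (z / \<omega>)\<bar> \<le> Re (z / \<omega>)"
      using z by (auto simp: \<omega>_def Re_divide Im_divide)
  qed
  then have "norm (F z) * exp (- (\<sigma> * Im z)) \<le> M"
    using \<omega> by (simp add: norm_f)
  then show ?thesis
    by (simp add: exp_minus field_simps)
qed

lemma phragmen_lindelof_exponential_type:
  fixes F :: "complex \<Rightarrow> complex"
  assumes hol: "F holomorphic_on UNIV" and \<sigma>: "\<sigma> \<ge> 0"
    and growth: "\<And>z. norm (F z) \<le> M * exp (\<sigma> * norm z)"
    and on_reals: "\<And>x. norm (F (complex_of_real x)) \<le> M"
  shows "norm (F z) \<le> M * exp (\<sigma> * \<bar>Im z\<bar>)"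
proof (cases "Im z \<ge> 0")
  case True
  then show ?thesis
    using phragmen_lindelof_upper_half_plane[OF assms] by simp
next
  case False
  have "norm (F (- (- z))) \<le> M * exp (\<sigma> * Im (- z))"
  proof (rule phragmen_lindelof_upper_half_plane[OF _ \<sigma>])
    show "(\<lambda>z. F (- z)) holomorphic_on UNIV"
      by (intro holomorphic_on_compose_gen[OF _ hol, unfolded o_def] holomorphic_intros) auto
    show "norm (F (- z)) \<le> M * exp (\<sigma> * norm z)" for z
      using growth[of "- z"] by simp
    show "norm (F (- complex_of_real x)) \<le> M" for x
      using on_reals[of "- x"] by simp
  qed (use False in auto)
  then show ?thesis
    using False by simp
qed

section \<open>Square-integrable entire functions of exponential type\<close>

text \<open>Square-integrability bounds the increments \<open>H z = P (z + \<delta>) - P z\<close> of a primitive \<open>P\<close> of \<open>F\<close> on the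
real axis, uniformly in \<open>\<delta> \<in> [0, 1]\<close>. The Phragmen-Lindelof bound carries this to the strip
\<open>\<bar>Im z\<bar> \<le> 1\<close>, and Cauchy's inequality to the derivative \<open>H' x = F (x + \<delta>) - F x\<close>. So \<open>F\<close> has bounded
oscillation on intervals of length 1, and its mean over such an interval is bounded as well.\<close>

lemma entire_L2_bounded_on_reals:
  fixes F :: "complex \<Rightarrow> complex"
  assumes hol: "F holomorphic_on UNIV" and \<sigma>: "\<sigma> \<ge> 0"
    and growth: "\<And>z. norm (F z) \<le> A * exp (\<sigma> * norm z)"
    and L2: "integrable lborel (\<lambda>x. (norm (F (complex_of_real x)))\<^sup>2)"
  obtains M where "\<And>x. norm (F (complex_of_real x)) \<le> M"
proof -
  define I where "I = (LINT x|lborel. (norm (F (complex_of_real x)))\<^sup>2)"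
  have A: "A \<ge> 0"
    using growth[of 0] by (simp add: order_trans[OF norm_ge_zero])
  obtain P where P: "\<And>z. (P has_field_derivative F z) (at z)"
    using holomorphic_convex_primitive'[of UNIV F] hol by auto
  have contF: "continuous_on S (\<lambda>x. F (complex_of_real x))" for S
    by (intro continuous_on_compose2[OF holomorphic_on_imp_continuous_on[OF hol]] continuous_intros) auto
  \<comment> \<open>Replaces the Cauchy-Schwarz inequality: \<open>\<bar>F\<bar>\<close> is at most \<open>1 + \<bar>F\<bar>\<^sup>2\<close>.\<close>
  have le_sq: "t \<le> 1 + t\<^sup>2" for t :: real
    using zero_le_power2[of "t - 1/2"] by (simp add: power2_eq_square algebra_simps)
  have int_ind: "integrable lborel (\<lambda>y. c * indicator {x..x+1::real} y)" for c x :: real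
    by simp
  have int_bound: "integrable lborel (\<lambda>y. c * indicator {x..x+1} y + (norm (F (complex_of_real y)))\<^sup>2)"
    and integral_bound: "(LINT y|lborel. c * indicator {x..x+1} y + (norm (F (complex_of_real y)))\<^sup>2) = c + I" for c x
    using L2 by (auto simp: I_def)
  have P_diff: "norm (P (complex_of_real x + complex_of_real \<delta>) - P (complex_of_real x)) \<le> 1 + I"
    if \<delta>: "0 \<le> \<delta>" "\<delta> \<le> 1" for x \<delta>
  proof -
    have "(LINT y|lborel. indicator {x..x+\<delta>} y *\<^sub>R F (complex_of_real y)) = P (of_real (x + \<delta>)) - P (of_real x)"
    proof (rule integral_FTC_atLeastAtMost)
      show "((\<lambda>y. P (complex_of_real y)) has_vector_derivative F (complex_of_real y)) (at y within {x..x+\<delta>})" for y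
        by (intro has_vector_derivative_real_field P)
    qed (use \<delta> contF in auto)
    moreover have "norm (LINT y|lborel. indicator {x..x+\<delta>} y *\<^sub>R F (complex_of_real y))
        \<le> (LINT y|lborel. 1 * indicator {x..x+1} y + (norm (F (complex_of_real y)))\<^sup>2)"
    proof (rule Bochner_Integration.integral_norm_bound_integral[OF _ int_bound])
      show "integrable lborel (\<lambda>y. indicator {x..x+\<delta>} y *\<^sub>R F (complex_of_real y))"
        by (rule borel_integrable_compact) (auto intro: contF)
      show "norm (indicator {x..x+\<delta>} y *\<^sub>R F (complex_of_real y))
          \<le> 1 * indicator {x..x+1} y + (norm (F (complex_of_real y)))\<^sup>2" for y
        using \<delta> le_sq[of "norm (F (complex_of_real y))"] by (auto simp: indicator_def)
    qed
    ultimately show ?thesis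
      using integral_bound[of 1 x] by simp
  qed
  define B where "B = max (A * exp \<sigma>) (1 + I)"
  have step: "norm (F (complex_of_real x)) \<le> norm (F (complex_of_real (x + \<delta>))) + B * exp \<sigma>"
    if \<delta>: "0 \<le> \<delta>" "\<delta> \<le> 1" for x \<delta>
  proof -
    define H where "H = (\<lambda>z. P (z + complex_of_real \<delta>) - P z)"
    have H': "(H has_field_derivative F (z + complex_of_real \<delta>) - F z) (at z)" for z
      unfolding H_def
      by (auto intro!: derivative_eq_intros DERIV_chain2[of P "F (z + complex_of_real \<delta>)" "\<lambda>z. z + complex_of_real \<delta>"] P)
    then have holH: "H holomorphic_on S" for S
      by (meson field_differentiable_at_within field_differentiable_def holomorphic_onI)
    have H_bound: "norm (H z) \<le> B * exp (\<sigma> * \<bar>Im z\<bar>)" for z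
    proof (rule phragmen_lindelof_exponential_type[OF holH \<sigma>])
      show "norm (H (complex_of_real x)) \<le> B" for x
        using P_diff[OF \<delta>, of x] by (auto simp: H_def B_def)
      fix z
      have "norm (P (z + complex_of_real \<delta>) - P z) \<le> A * exp (\<sigma> * (norm z + 1)) * norm ((z + complex_of_real \<delta>) - z)"
      proof (rule field_differentiable_bound[OF convex_closed_segment has_field_derivative_at_within[OF P]])
        fix w assume "w \<in> closed_segment z (z + complex_of_real \<delta>)"
        then obtain u where u: "0 \<le> u" "u \<le> 1" "w = z + of_real (u * \<delta>)"
          by (auto simp: in_segment algebra_simps scaleR_conv_of_real)
        have "norm w \<le> norm z + u * \<delta>"
          using u \<delta> norm_triangle_ineq[of z "of_real (u * \<delta>)"] by (simp add: norm_mult)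
        also have "\<dots> \<le> norm z + 1"
          using u \<delta> by (simp add: mult_le_one)
        finally have "A * exp (\<sigma> * norm w) \<le> A * exp (\<sigma> * (norm z + 1))"
          using A \<sigma> by (intro mult_left_mono exp_mono) (auto intro: mult_left_mono)
        then show "norm (F w) \<le> A * exp (\<sigma> * (norm z + 1))"
          using growth[of w] by linarith
      qed auto
      also have "\<dots> \<le> A * exp (\<sigma> * (norm z + 1)) * 1"
        using A \<delta> by (intro mult_left_mono) auto
      also have "\<dots> = A * exp \<sigma> * exp (\<sigma> * norm z)"
        by (simp add: algebra_simps exp_add)
      also have "\<dots> \<le> B * exp (\<sigma> * norm z)"
        by (intro mult_right_mono) (auto simp: B_def)
      finally show "norm (H z) \<le> B * exp (\<sigma> * norm z)"
        by (simp add: H_def)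
    qed
    have B: "B \<ge> 0"
      using A by (simp add: B_def le_max_iff_disj)
    have "norm ((deriv ^^ 1) H (complex_of_real x)) \<le> fact 1 * (B * exp \<sigma>) / 1 ^ 1"
    proof (rule Cauchy_inequality)
      fix z assume "norm (complex_of_real x - z) = 1"
      then have "\<bar>Im z\<bar> \<le> 1"
        using abs_Im_le_cmod[of "complex_of_real x - z"] by simp
      then have "B * exp (\<sigma> * \<bar>Im z\<bar>) \<le> B * exp (\<sigma> * 1)"
        using B \<sigma> by (intro mult_left_mono exp_mono) auto
      then show "norm (H z) \<le> B * exp \<sigma>"
        using H_bound[of z] by simp
    qed (auto intro: holH holomorphic_on_imp_continuous_on)
    then have "norm (F (complex_of_real x + complex_of_real \<delta>) - F (complex_of_real x)) \<le> B * exp \<sigma>"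
      using DERIV_imp_deriv[OF H', of "complex_of_real x"] by simp
    then show ?thesis
      using norm_triangle_sub[of "F (complex_of_real x)" "F (complex_of_real x + complex_of_real \<delta>)"]
      by (simp add: norm_minus_commute)
  qed
  have "norm (F (complex_of_real x)) \<le> (1 + B * exp \<sigma>) + I" for x
  proof -
    have "norm (F (complex_of_real x)) = (LINT y|lborel. norm (F (complex_of_real x)) * indicator {x..x+1} y)"
      by simp
    also have "\<dots> \<le> (LINT y|lborel. (1 + B * exp \<sigma>) * indicator {x..x+1} y + (norm (F (complex_of_real y)))\<^sup>2)"
    proof (rule integral_mono[OF int_ind int_bound])
      fix y
      show "norm (F (complex_of_real x)) * indicator {x..x+1} y
          \<le> (1 + B * exp \<sigma>) * indicator {x..x+1} y + (norm (F (complex_of_real y)))\<^sup>2"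
        using step[of "y - x" x] le_sq[of "norm (F (complex_of_real y))"]
        by (auto simp: indicator_def)
    qed
    finally show ?thesis
      using integral_bound[of "1 + B * exp \<sigma>" x] by simp
  qed
  then show ?thesis
    using that by blast
qed

section \<open>The reproducing formula\<close>

text \<open>A form of Jordan's lemma. The difference of the primitive is estimated along three sides of a
rectangle of half-width \<open>n\<^sup>2\<close> and height \<open>n\<close>, in the upper or the lower half-plane according to the
sign \<open>s\<close>. With these proportions the bound "maximum times length" suffices on every side: the vertical
sides contribute \<open>O(1/n)\<close>, because \<open>u\<close> is \<open>O(1/n\<^sup>2)\<close> there, and the horizontal side decays
exponentially.\<close>

lemma primitive_difference_tendsto_0:
  fixes U u :: "complex \<Rightarrow> complex" and s c D :: real
  assumes U: "\<And>z. (U has_field_derivative u z) (at z)"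
    and s: "\<bar>s\<bar> = 1" and c: "c > 0"
    and bound: "\<And>z. s * Im z \<ge> 0 \<Longrightarrow> norm z * norm (u z) \<le> D * exp (- (c * \<bar>Im z\<bar>))"
  shows "(\<lambda>n. U (of_real ((real n)\<^sup>2)) - U (of_real (- ((real n)\<^sup>2)))) \<longlonglongrightarrow> 0"
proof (rule Lim_null_comparison)
  have D: "D \<ge> 0"
    using bound[of 0] by simp
  have seg: "norm (U b - U a) \<le> D * E / r * norm (b - a)"
    if "r > 0"
      and "\<And>z. z \<in> closed_segment a b \<Longrightarrow> s * Im z \<ge> 0 \<and> r \<le> norm z \<and> exp (- (c * \<bar>Im z\<bar>)) \<le> E"
    for a b :: complex and r E :: real
  proof (rule field_differentiable_bound[OF convex_closed_segment has_field_derivative_at_within[OF U]])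
    fix z assume "z \<in> closed_segment a b"
    note z = that(2)[OF this]
    have "r * norm (u z) \<le> norm z * norm (u z)"
      using z by (intro mult_right_mono) auto
    also have "\<dots> \<le> D * exp (- (c * \<bar>Im z\<bar>))"
      using z bound by simp
    also have "\<dots> \<le> D * E"
      using z D by (intro mult_left_mono) auto
    finally show "norm (u z) \<le> D * E / r"
      using \<open>r > 0\<close> by (simp add: field_simps)
  qed auto
  have "norm (U (of_real ((real n)\<^sup>2)) - U (of_real (- ((real n)\<^sup>2))))
      \<le> 2 * D / real n + 2 * D * real n * exp (- (c * real n))" if n: "n > 0" for n
  proof -
    define N where "N = real n"
    have N: "N \<ge> 1"
      using n by (simp add: N_def)
    have s_sq: "s * s = 1"
      using s by (metis abs_mult_self_eq mult_1)
    have vertical: "norm (U (Complex x (s * N)) - U (of_real x)) \<le> D / N" if x: "\<bar>x\<bar> = N\<^sup>2" for x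
    proof -
      have "norm (U (Complex x (s * N)) - U (of_real x)) \<le> D * 1 / N\<^sup>2 * norm (Complex x (s * N) - of_real x)"
      proof (rule seg)
        fix z assume "z \<in> closed_segment (of_real x) (Complex x (s * N))"
        then obtain t where t: "0 \<le> t" "t \<le> 1" "z = Complex x (t * (s * N))"
          by (auto simp: in_segment complex_eq_iff algebra_simps)
        have "s * Im z = (s * s) * (t * N)"
          by (simp add: t)
        then have "s * Im z \<ge> 0"
          using t(1) N s_sq by simp
        moreover have "N\<^sup>2 \<le> norm z"
          using abs_Re_le_cmod[of z] x by (simp add: t)
        ultimately show "s * Im z \<ge> 0 \<and> N\<^sup>2 \<le> norm z \<and> exp (- (c * \<bar>Im z\<bar>)) \<le> 1"
          using c by simp
      qed (use N in auto)
      also have "Complex x (s * N) - of_real x = of_real (s * N) * \<i>"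
        by (simp add: complex_eq_iff)
      finally show ?thesis
        using N s by (simp add: norm_mult abs_mult power2_eq_square)
    qed
    have horizontal: "norm (U (Complex (N\<^sup>2) (s * N)) - U (Complex (- (N\<^sup>2)) (s * N))) \<le> 2 * D * N * exp (- (c * N))"
    proof -
      have "norm (U (Complex (N\<^sup>2) (s * N)) - U (Complex (- (N\<^sup>2)) (s * N)))
          \<le> D * exp (- (c * N)) / N * norm (Complex (N\<^sup>2) (s * N) - Complex (- (N\<^sup>2)) (s * N))"
      proof (rule seg)
        fix z assume "z \<in> closed_segment (Complex (- (N\<^sup>2)) (s * N)) (Complex (N\<^sup>2) (s * N))"
        then have z: "Im z = s * N"
          by (auto simp: in_segment) (simp add: algebra_simps)
        then have "s * Im z = N" "\<bar>Im z\<bar> = N"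
          using s N s_sq by (auto simp: abs_mult simp flip: mult.assoc)
        then show "s * Im z \<ge> 0 \<and> N \<le> norm z \<and> exp (- (c * \<bar>Im z\<bar>)) \<le> exp (- (c * N))"
          using N abs_Im_le_cmod[of z] by simp
      qed (use N in auto)
      also have "Complex (N\<^sup>2) (s * N) - Complex (- (N\<^sup>2)) (s * N) = of_real (2 * N\<^sup>2)"
        by (simp add: complex_eq_iff)
      also have "norm (of_real (2 * N\<^sup>2) :: complex) = 2 * N\<^sup>2"
        by (subst norm_of_real) simp
      finally show ?thesis
        using N by (simp add: power2_eq_square field_simps)
    qed
    have "norm (U (of_real (N\<^sup>2)) - U (of_real (- (N\<^sup>2)))) \<le> D / N + 2 * D * N * exp (- (c * N)) + D / N"
      using vertical[of "N\<^sup>2"] vertical[of "- (N\<^sup>2)"] horizontal N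
      by (smt (verit) abs_of_nonneg abs_minus_cancel zero_le_power2 norm_minus_commute norm_triangle_sub
            norm_diff_triangle_le)
    then show ?thesis
      by (simp add: N_def)
  qed
  then show "\<forall>\<^sub>F n in sequentially. norm (U (of_real ((real n)\<^sup>2)) - U (of_real (- ((real n)\<^sup>2))))
      \<le> 2 * D / real n + 2 * D * real n * exp (- (c * real n))"
    by (rule eventually_mono[OF eventually_gt_at_top[of 0]])
  show "(\<lambda>n. 2 * D / real n + 2 * D * real n * exp (- (c * real n))) \<longlonglongrightarrow> 0"
    using c by real_asymp
qed

text \<open>The inverse Fourier transform of the indicator function of \<open>[-\<sigma>, \<sigma>]\<close>, which is the reproducing
kernel of the Paley-Wiener space of type \<open>\<sigma>\<close>.\<close>

definition sinc_kernel :: "real \<Rightarrow> real \<Rightarrow> real" where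
  "sinc_kernel \<sigma> x = (if x = 0 then \<sigma> / pi else sin (\<sigma> * x) / (pi * x))"

lemma sinc_kernel_eq_sinc: "sinc_kernel \<sigma> x = \<sigma> / pi * sinc (\<sigma> * x)"
  by (simp add: sinc_kernel_def)

lemma continuous_on_sinc_kernel [continuous_intros]:
  "continuous_on S f \<Longrightarrow> continuous_on S (\<lambda>x. sinc_kernel \<sigma> (f x))"
  unfolding sinc_kernel_eq_sinc by (intro continuous_intros)

lemma borel_measurable_sinc_kernel [measurable]: "sinc_kernel \<sigma> \<in> borel_measurable borel"
  by (intro borel_measurable_continuous_onI continuous_intros)

lemma normalized_sinc_of_real: "normalized_sinc (complex_of_real x) = of_real (sinc_kernel pi x)"
  by (simp add: normalized_sinc_def sinc_kernel_def flip: sin_of_real of_real_mult)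

lemma sinc_kernel_minus [simp]: "sinc_kernel \<sigma> (- x) = sinc_kernel \<sigma> x"
  by (simp add: sinc_kernel_def)

lemma sinc_kernel_sq_le: "(sinc_kernel \<sigma> x)\<^sup>2 \<le> (1 + \<sigma>\<^sup>2) * inverse (1 + x\<^sup>2)"
proof -
  have 1: "(sinc_kernel \<sigma> x)\<^sup>2 \<le> \<sigma>\<^sup>2"
  proof -
    have "\<bar>sinc_kernel \<sigma> x\<bar> \<le> \<bar>\<sigma>\<bar>"
    proof (cases "x = 0")
      case True
      have "\<bar>\<sigma>\<bar> * 1 \<le> \<bar>\<sigma>\<bar> * pi"
        using pi_ge_two by (intro mult_left_mono) auto
      then show ?thesis
        using True by (simp add: sinc_kernel_def field_simps)
    next
      case False
      have "\<bar>sin (\<sigma> * x)\<bar> \<le> \<bar>\<sigma>\<bar> * \<bar>x\<bar>"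
        using abs_sin_x_le_abs_x[of "\<sigma> * x"] by (simp add: abs_mult)
      also have "\<bar>\<sigma>\<bar> * \<bar>x\<bar> = \<bar>\<sigma>\<bar> * \<bar>x\<bar> * 1"
        by simp
      also have "\<dots> \<le> \<bar>\<sigma>\<bar> * \<bar>x\<bar> * pi"
        using pi_ge_two by (intro mult_left_mono) auto
      finally show ?thesis
        using False by (simp add: sinc_kernel_def abs_mult field_simps)
    qed
    then show ?thesis
      by (simp add: abs_le_square_iff)
  qed
  have "x\<^sup>2 * (sinc_kernel \<sigma> x)\<^sup>2 = (x * sinc_kernel \<sigma> x)\<^sup>2"
    by (simp add: power_mult_distrib)
  also have "\<dots> \<le> 1\<^sup>2"
  proof (rule power2_le_iff_abs_le[THEN iffD2])
    have "\<bar>sin (\<sigma> * x)\<bar> \<le> pi"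
      using pi_ge_two abs_sin_le_one[of "\<sigma> * x"] by linarith
    then show "\<bar>x * sinc_kernel \<sigma> x\<bar> \<le> 1"
      by (simp add: sinc_kernel_def abs_mult)
  qed simp
  finally have "(sinc_kernel \<sigma> x)\<^sup>2 * (1 + x\<^sup>2) \<le> 1 + \<sigma>\<^sup>2"
    using 1 by (simp add: algebra_simps)
  moreover have "1 + x\<^sup>2 > 0"
    by (simp add: add_pos_nonneg)
  ultimately show ?thesis
    by (simp add: field_simps)
qed

lemma integrable_sinc_kernel_bound: "integrable lborel (\<lambda>x::real. a * inverse (1 + x\<^sup>2))"
  using integrable_inverse_1_plus_square by (simp add: set_integrable_def einterval_def)

lemma integrable_sinc_kernel_sq: "integrable lborel (\<lambda>x. (sinc_kernel \<sigma> x)\<^sup>2)"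
proof (rule Bochner_Integration.integrable_bound[OF integrable_sinc_kernel_bound[of "1 + \<sigma>\<^sup>2"]])
  show "AE x in lborel. norm ((sinc_kernel \<sigma> x)\<^sup>2) \<le> norm ((1 + \<sigma>\<^sup>2) * inverse (1 + x\<^sup>2))"
    using sinc_kernel_sq_le[of \<sigma>] by (auto intro: order_trans[OF _ abs_ge_self])
qed simp

text \<open>Write \<open>F z = F 0 + z * q z\<close> with \<open>q\<close> entire. The constant term contributes the sine integral, whose
limit is known. In the rest the kernel's denominator cancels, leaving \<open>q x * sin (\<sigma> x) / \<pi>\<close>; its two
exponentials \<open>q x * exp (\<plusminus>\<i> \<sigma> x)\<close> are treated in the upper and the lower half-plane, where the gap
between \<open>\<tau>\<close> and \<open>\<sigma>\<close> gives exponential decay.\<close>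

lemma truncated_reproducing_formula:
  fixes F :: "complex \<Rightarrow> complex"
  assumes hol: "F holomorphic_on UNIV"
    and growth: "\<And>z. norm (F z) \<le> C * exp (\<tau> * \<bar>Im z\<bar>)"
    and \<tau>: "0 \<le> \<tau>" "\<tau> < \<sigma>"
  shows "(\<lambda>n. LINT x|lborel. indicator {- ((real n)\<^sup>2)..(real n)\<^sup>2} x *\<^sub>R
           (F (complex_of_real x) * complex_of_real (sinc_kernel \<sigma> x))) \<longlonglongrightarrow> F 0"
proof -
  define q where "q = (\<lambda>z. if z = 0 then deriv F 0 else (F z - F 0) / (z - 0))"
  have q: "F z = F 0 + z * q z" for z
    by (simp add: q_def)
  have holq: "q holomorphic_on UNIV"
    unfolding q_def by (rule pole_lemma) (use hol in auto)
  have "\<exists>U. \<forall>z. (U has_field_derivative q z * exp (of_real s * (\<i> * (of_real \<sigma> * z)))) (at z)" for s :: real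
  proof -
    have "(\<lambda>z. q z * exp (of_real s * (\<i> * (of_real \<sigma> * z)))) holomorphic_on UNIV"
      by (intro holomorphic_intros holq)
    from holomorphic_convex_primitive'[OF convex_UNIV open_UNIV this] show ?thesis
      by (metis UNIV_I)
  qed
  then obtain U where U: "\<And>s z. (U s has_field_derivative q z * exp (of_real s * (\<i> * (of_real \<sigma> * z)))) (at z)"
    by metis
  have U_lim: "(\<lambda>n. U s (of_real ((real n)\<^sup>2)) - U s (of_real (- ((real n)\<^sup>2)))) \<longlonglongrightarrow> 0"
    if s: "\<bar>s\<bar> = 1" for s
  proof (rule primitive_difference_tendsto_0[OF U s])
    show "\<sigma> - \<tau> > 0"
      using \<tau> by simp
    fix z assume z: "s * Im z \<ge> 0"
    have *: "s * Im z = \<bar>Im z\<bar>"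
      using z s by (metis abs_mult abs_of_nonneg mult_1)
    have "norm z * norm (q z) = norm (F z - F 0)"
      by (simp add: q[of z] norm_mult)
    also have "\<dots> \<le> C * exp (\<tau> * \<bar>Im z\<bar>) + C * exp (\<tau> * \<bar>Im 0\<bar>)"
      by (intro norm_triangle_le_diff add_mono growth)
    also have "\<dots> \<le> C * exp (\<tau> * \<bar>Im z\<bar>) + C * exp (\<tau> * \<bar>Im z\<bar>)"
    proof -
      have "C \<ge> 0"
        using growth[of 0] by (simp add: order_trans[OF norm_ge_zero])
      then show ?thesis
        using \<tau> by (intro add_mono mult_left_mono exp_mono) auto
    qed
    finally have "norm z * norm (q z) \<le> 2 * C * exp (\<tau> * \<bar>Im z\<bar>)"
      by simp
    then have "norm z * norm (q z) * exp (- (\<sigma> * \<bar>Im z\<bar>)) \<le> 2 * C * exp (\<tau> * \<bar>Im z\<bar>) * exp (- (\<sigma> * \<bar>Im z\<bar>))"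
      by (intro mult_right_mono) auto
    moreover have "norm (exp (of_real s * (\<i> * (of_real \<sigma> * z)))) = exp (- (\<sigma> * \<bar>Im z\<bar>))"
      by (simp add: mult.left_commute flip: *)
    moreover have "exp (\<tau> * \<bar>Im z\<bar>) * exp (- (\<sigma> * \<bar>Im z\<bar>)) = exp (- ((\<sigma> - \<tau>) * \<bar>Im z\<bar>))"
      by (simp add: algebra_simps flip: exp_add)
    ultimately show "norm z * norm (q z * exp (of_real s * (\<i> * (of_real \<sigma> * z))))
        \<le> 2 * C * exp (- ((\<sigma> - \<tau>) * \<bar>Im z\<bar>))"
      by (simp only: norm_mult mult.assoc)
  qed
  \<comment> \<open>an explicit primitive of the integrand on the real axis\<close>
  define W where "W = (\<lambda>x. F 0 * complex_of_real (Si (\<sigma> * x) / pi)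
      + (U 1 (complex_of_real x) - U (-1) (complex_of_real x)) / (2 * \<i> * of_real pi))"
  have W': "(W has_vector_derivative F (complex_of_real x) * complex_of_real (sinc_kernel \<sigma> x)) (at x within S)" for x S
  proof -
    have Si': "((\<lambda>x. complex_of_real (Si (\<sigma> * x) / pi)) has_vector_derivative of_real (sinc_kernel \<sigma> x)) (at x within S)"
    proof (rule has_vector_derivative_of_real, rule has_field_derivative_at_within)
      show "((\<lambda>x. Si (\<sigma> * x) / pi) has_real_derivative sinc_kernel \<sigma> x) (at x)"
        unfolding sinc_kernel_eq_sinc
        by (rule derivative_eq_intros DERIV_chain2[OF DERIV_Si] refl | simp)+
    qed
    have "(W has_vector_derivative F 0 * complex_of_real (sinc_kernel \<sigma> x)
        + (q (of_real x) * exp (of_real 1 * (\<i> * (of_real \<sigma> * of_real x)))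
           - q (of_real x) * exp (of_real (-1) * (\<i> * (of_real \<sigma> * of_real x)))) / (2 * \<i> * of_real pi)) (at x within S)"
      unfolding W_def divide_inverse[of "_ - _"]
      by (intro has_vector_derivative_add has_vector_derivative_mult_right has_vector_derivative_mult_left
          has_vector_derivative_diff has_vector_derivative_real_field U Si')
    also have "(q (of_real x) * exp (of_real 1 * (\<i> * (of_real \<sigma> * of_real x)))
           - q (of_real x) * exp (of_real (-1) * (\<i> * (of_real \<sigma> * of_real x)))) / (2 * \<i> * of_real pi)
        = q (of_real x) * of_real (sin (\<sigma> * x)) / of_real pi"
      unfolding sin_of_real[symmetric] sin_exp_eq by (simp add: field_simps)
    also have "F 0 * complex_of_real (sinc_kernel \<sigma> x) + \<dots> = F (of_real x) * of_real (sinc_kernel \<sigma> x)"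
      by (subst q[of "of_real x"]) (auto simp: sinc_kernel_def field_simps)
    finally show ?thesis .
  qed
  have cont: "continuous_on S (\<lambda>x. F (complex_of_real x) * complex_of_real (sinc_kernel \<sigma> x))" for S
    by (intro continuous_on_compose2[OF holomorphic_on_imp_continuous_on[OF hol]] continuous_intros) auto
  have FTC: "(LINT x|lborel. indicator {- ((real n)\<^sup>2)..(real n)\<^sup>2} x *\<^sub>R
           (F (complex_of_real x) * complex_of_real (sinc_kernel \<sigma> x))) = W ((real n)\<^sup>2) - W (- ((real n)\<^sup>2))" for n
    by (rule integral_FTC_atLeastAtMost[OF _ W' cont]) (simp add: order_trans[of _ 0])
  have lim: "filterlim (\<lambda>n. \<sigma> * (real n)\<^sup>2) at_top sequentially"
    using \<tau> by real_asymp
  have "(\<lambda>n. F 0 * complex_of_real (2 * Si (\<sigma> * (real n)\<^sup>2) / pi)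
      + ((U 1 (of_real ((real n)\<^sup>2)) - U 1 (of_real (- ((real n)\<^sup>2))))
         - (U (-1) (of_real ((real n)\<^sup>2)) - U (-1) (of_real (- ((real n)\<^sup>2))))) / (2 * \<i> * of_real pi))
      \<longlonglongrightarrow> F 0 * complex_of_real (2 * (pi / 2) / pi) + (0 - 0) / (2 * \<i> * of_real pi)"
    by (intro tendsto_intros filterlim_compose[OF Si_at_top lim] U_lim) auto
  moreover have "W ((real n)\<^sup>2) - W (- ((real n)\<^sup>2)) = F 0 * complex_of_real (2 * Si (\<sigma> * (real n)\<^sup>2) / pi)
      + ((U 1 (of_real ((real n)\<^sup>2)) - U 1 (of_real (- ((real n)\<^sup>2))))
         - (U (-1) (of_real ((real n)\<^sup>2)) - U (-1) (of_real (- ((real n)\<^sup>2))))) / (2 * \<i> * of_real pi)" for n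
  proof -
    have "Si (\<sigma> * - ((real n)\<^sup>2)) = - Si (\<sigma> * (real n)\<^sup>2)"
      using Si_neg[of "\<sigma> * (real n)\<^sup>2"] \<tau> by simp
    then show ?thesis
      unfolding W_def by (simp add: field_simps)
  qed
  ultimately show ?thesis
    unfolding FTC by simp
qed

lemma mult_le_sum_squares: "a * b \<le> a\<^sup>2 + b\<^sup>2" for a b :: real
  using sum_squares_bound[of a b] zero_le_power2[of a] zero_le_power2[of b] by linarith

lemma integrable_mult_sinc_kernel:
  fixes f :: "real \<Rightarrow> complex"
  assumes [measurable]: "f \<in> borel_measurable borel"
    and f: "integrable lborel (\<lambda>x. (norm (f x))\<^sup>2)"
  shows "integrable lborel (\<lambda>x. f x * of_real (sinc_kernel \<sigma> (t - x)))"
    and "(LINT x|lborel. norm (f x * of_real (sinc_kernel \<sigma> (t - x))))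
      \<le> (LINT x|lborel. (norm (f x))\<^sup>2) + (LINT x|lborel. (sinc_kernel \<sigma> x)\<^sup>2)"
proof -
  have k: "integrable lborel (\<lambda>x. (sinc_kernel \<sigma> (t - x))\<^sup>2)"
    using lborel_integrable_real_affine[OF integrable_sinc_kernel_sq, of "-1" \<sigma> t] by simp
  have bound: "norm (f x * of_real (sinc_kernel \<sigma> (t - x))) \<le> (norm (f x))\<^sup>2 + (sinc_kernel \<sigma> (t - x))\<^sup>2" for x
    using mult_le_sum_squares[of "norm (f x)" "\<bar>sinc_kernel \<sigma> (t - x)\<bar>"] by (simp add: norm_mult)
  show int: "integrable lborel (\<lambda>x. f x * of_real (sinc_kernel \<sigma> (t - x)))"
    using bound by (intro Bochner_Integration.integrable_bound[OF Bochner_Integration.integrable_add[OF f k]])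
      (auto intro: order_trans[OF _ abs_ge_self])
  have "(LINT x|lborel. norm (f x * of_real (sinc_kernel \<sigma> (t - x))))
      \<le> (LINT x|lborel. (norm (f x))\<^sup>2 + (sinc_kernel \<sigma> (t - x))\<^sup>2)"
    by (intro integral_mono integrable_norm[OF int] Bochner_Integration.integrable_add f k bound)
  also have "\<dots> = (LINT x|lborel. (norm (f x))\<^sup>2) + (LINT x|lborel. (sinc_kernel \<sigma> (t - x))\<^sup>2)"
    by (rule Bochner_Integration.integral_add[OF f k])
  also have "(LINT x|lborel. (sinc_kernel \<sigma> (t - x))\<^sup>2) = (LINT x|lborel. (sinc_kernel \<sigma> x)\<^sup>2)"
    using lborel_integral_real_affine[of "-1" "\<lambda>x. (sinc_kernel \<sigma> x)\<^sup>2" t] by simp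
  finally show "(LINT x|lborel. norm (f x * of_real (sinc_kernel \<sigma> (t - x))))
      \<le> (LINT x|lborel. (norm (f x))\<^sup>2) + (LINT x|lborel. (sinc_kernel \<sigma> x)\<^sup>2)" .
qed

text \<open>The formula holds for each kernel of type \<open>\<sigma> > \<tau>\<close>, by the truncated formula: \<open>F\<close> is bounded on the
real axis, hence by \<open>exp (\<rho> \<bar>Im z\<bar>)\<close> for every \<open>\<rho> > \<tau>\<close>, up to a constant. The kernels of type
\<open>\<sigma> \<in> (\<tau>, \<tau> + 1]\<close> have a common square-integrable majorant, so \<open>\<sigma>\<close> can tend to \<open>\<tau>\<close>.\<close>

lemma reproducing_formula_at_0:
  fixes F :: "complex \<Rightarrow> complex"
  assumes hol: "F holomorphic_on UNIV" and type: "exponential_type_le F \<tau>" and \<tau>: "\<tau> \<ge> 0"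
    and L2: "integrable lborel (\<lambda>x. (norm (F (complex_of_real x)))\<^sup>2)"
  shows "F 0 = (LINT x|lborel. F (complex_of_real x) * complex_of_real (sinc_kernel \<tau> x))"
proof -
  have [measurable]: "(\<lambda>x. F (complex_of_real x)) \<in> borel_measurable borel"
    by (intro borel_measurable_continuous_onI continuous_on_compose2[OF holomorphic_on_imp_continuous_on[OF hol]]
        continuous_intros) auto
  have int: "integrable lborel (\<lambda>x. F (complex_of_real x) * complex_of_real (sinc_kernel \<sigma> x))" for \<sigma>
    using integrable_mult_sinc_kernel(1)[of "\<lambda>x. F (complex_of_real x)" \<sigma> 0] L2 by simp
  have larger: "(LINT x|lborel. F (complex_of_real x) * complex_of_real (sinc_kernel \<sigma> x)) = F 0" if "\<sigma> > \<tau>" for \<sigma>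
  proof -
    define \<rho> where "\<rho> = (\<tau> + \<sigma>) / 2"
    have \<rho>: "0 \<le> \<rho>" "\<tau> < \<rho>" "\<rho> < \<sigma>"
      using that \<tau> by (auto simp: \<rho>_def)
    obtain A where A: "\<And>z. norm (F z) \<le> A * exp (\<rho> * norm z)"
      using type \<rho> unfolding exponential_type_le_def
      by (metis add_diff_cancel_left' add.commute diff_add_cancel diff_gt_0_iff_gt)
    obtain M where M: "\<And>x. norm (F (complex_of_real x)) \<le> M"
      using entire_L2_bounded_on_reals[OF hol \<rho>(1) A L2] by blast
    have growth: "norm (F z) \<le> max A M * exp (\<rho> * \<bar>Im z\<bar>)" for z
    proof (rule phragmen_lindelof_exponential_type[OF hol \<rho>(1)])
      show "norm (F z) \<le> max A M * exp (\<rho> * norm z)" for z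
        by (rule order_trans[OF A]) (auto intro: mult_right_mono)
      show "norm (F (complex_of_real x)) \<le> max A M" for x
        using M[of x] by simp
    qed
    have "(\<lambda>n. LINT x|lborel. indicator {- ((real n)\<^sup>2)..(real n)\<^sup>2} x *\<^sub>R
           (F (complex_of_real x) * complex_of_real (sinc_kernel \<sigma> x)))
        \<longlonglongrightarrow> (LINT x|lborel. F (complex_of_real x) * complex_of_real (sinc_kernel \<sigma> x))"
    proof (rule integral_dominated_convergence[where w = "\<lambda>x. norm (F (complex_of_real x) * complex_of_real (sinc_kernel \<sigma> x))"])
      show "AE x in lborel. (\<lambda>n. indicator {- ((real n)\<^sup>2)..(real n)\<^sup>2} x *\<^sub>R
           (F (complex_of_real x) * complex_of_real (sinc_kernel \<sigma> x)))
         \<longlonglongrightarrow> F (complex_of_real x) * complex_of_real (sinc_kernel \<sigma> x)"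
      proof (rule AE_I2, rule tendsto_eventually)
        fix x :: real
        have "filterlim (\<lambda>n. (real n)\<^sup>2) at_top sequentially"
          by real_asymp
        then have "\<forall>\<^sub>F n in sequentially. \<bar>x\<bar> \<le> (real n)\<^sup>2"
          by (simp add: filterlim_at_top)
        then show "\<forall>\<^sub>F n in sequentially. indicator {- ((real n)\<^sup>2)..(real n)\<^sup>2} x *\<^sub>R
           (F (complex_of_real x) * complex_of_real (sinc_kernel \<sigma> x)) = F (complex_of_real x) * complex_of_real (sinc_kernel \<sigma> x)"
          by eventually_elim (auto simp: indicator_def)
      qed
    qed (use int[of \<sigma>] in \<open>auto simp: indicator_def\<close>)
    then show ?thesis
      using truncated_reproducing_formula[OF hol growth \<rho>(1,3)] LIMSEQ_unique by blast
  qed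
  have "(\<lambda>n. LINT x|lborel. F (complex_of_real x) * complex_of_real (sinc_kernel (\<tau> + 1 / real (Suc n)) x))
      \<longlonglongrightarrow> (LINT x|lborel. F (complex_of_real x) * complex_of_real (sinc_kernel \<tau> x))"
  proof (rule integral_dominated_convergence[where
        w = "\<lambda>x. (norm (F (complex_of_real x)))\<^sup>2 + (1 + (\<tau> + 1)\<^sup>2) * inverse (1 + x\<^sup>2)"])
    show "integrable lborel (\<lambda>x. (norm (F (complex_of_real x)))\<^sup>2 + (1 + (\<tau> + 1)\<^sup>2) * inverse (1 + x\<^sup>2))"
      by (rule Bochner_Integration.integrable_add[OF L2 integrable_sinc_kernel_bound])
    show "AE x in lborel. (\<lambda>n. F (complex_of_real x) * complex_of_real (sinc_kernel (\<tau> + 1 / real (Suc n)) x))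
        \<longlonglongrightarrow> F (complex_of_real x) * complex_of_real (sinc_kernel \<tau> x)"
    proof (rule AE_I2)
      fix x :: real
      have "(\<lambda>n. \<tau> + 1 / real (Suc n)) \<longlonglongrightarrow> \<tau> + 0"
        by (intro tendsto_intros LIMSEQ_inverse_real_of_nat[unfolded inverse_eq_divide])
      then have "(\<lambda>n. sinc_kernel (\<tau> + 1 / real (Suc n)) x) \<longlonglongrightarrow> sinc_kernel \<tau> x"
        unfolding sinc_kernel_def by (cases "x = 0") (auto intro!: tendsto_intros)
      then show "(\<lambda>n. F (complex_of_real x) * complex_of_real (sinc_kernel (\<tau> + 1 / real (Suc n)) x))
          \<longlonglongrightarrow> F (complex_of_real x) * complex_of_real (sinc_kernel \<tau> x)"
        by (intro tendsto_intros)
    qed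
    show "AE x in lborel. norm (F (complex_of_real x) * complex_of_real (sinc_kernel (\<tau> + 1 / real (Suc n)) x))
        \<le> (norm (F (complex_of_real x)))\<^sup>2 + (1 + (\<tau> + 1)\<^sup>2) * inverse (1 + x\<^sup>2)" for n
    proof (rule AE_I2)
      fix x :: real
      let ?\<sigma> = "\<tau> + 1 / real (Suc n)"
      have "norm (F (complex_of_real x) * complex_of_real (sinc_kernel ?\<sigma> x))
          \<le> (norm (F (complex_of_real x)))\<^sup>2 + (sinc_kernel ?\<sigma> x)\<^sup>2"
        using mult_le_sum_squares[of "norm (F (complex_of_real x))" "\<bar>sinc_kernel ?\<sigma> x\<bar>"] by (simp add: norm_mult)
      also have "(sinc_kernel ?\<sigma> x)\<^sup>2 \<le> (1 + ?\<sigma>\<^sup>2) * inverse (1 + x\<^sup>2)"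
        by (rule sinc_kernel_sq_le)
      also have "\<dots> \<le> (1 + (\<tau> + 1)\<^sup>2) * inverse (1 + x\<^sup>2)"
        using \<tau> by (intro mult_right_mono add_left_mono power_mono) auto
      finally show "norm (F (complex_of_real x) * complex_of_real (sinc_kernel ?\<sigma> x))
          \<le> (norm (F (complex_of_real x)))\<^sup>2 + (1 + (\<tau> + 1)\<^sup>2) * inverse (1 + x\<^sup>2)"
        by simp
    qed
  qed auto
  moreover have "(\<lambda>n. LINT x|lborel. F (complex_of_real x) * complex_of_real (sinc_kernel (\<tau> + 1 / real (Suc n)) x))
      = (\<lambda>n. F 0)"
    by (intro ext larger) simp
  ultimately show ?thesis
    by (metis LIMSEQ_unique tendsto_const)
qed

lemma paley_wienerD:
  assumes "F \<in> paley_wiener \<tau>"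
  shows "F holomorphic_on UNIV" "exponential_type_le F \<tau>"
    and "(\<lambda>x. F (complex_of_real x)) \<in> borel_measurable borel"
    and "integrable lborel (\<lambda>x. (norm (F (complex_of_real x)))\<^sup>2)"
proof -
  show hol: "F holomorphic_on UNIV" and "exponential_type_le F \<tau>"
    using assms by (auto simp: paley_wiener_def)
  show [measurable]: "(\<lambda>x. F (complex_of_real x)) \<in> borel_measurable borel"
    by (intro borel_measurable_continuous_onI continuous_on_compose2[OF holomorphic_on_imp_continuous_on[OF hol]]
        continuous_intros) auto
  have "integrable lebesgue (\<lambda>x. (norm (F (complex_of_real x)))\<^sup>2)"
    using assms by (auto simp: paley_wiener_def L2_def)
  then show "integrable lborel (\<lambda>x. (norm (F (complex_of_real x)))\<^sup>2)"
    by (subst (asm) integrable_completion) auto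
qed

text \<open>The class of functions is invariant under real translations, so the case \<open>t = 0\<close> suffices.\<close>

theorem paley_wiener_reproducing_formula:
  assumes F: "F \<in> paley_wiener \<tau>" and \<tau>: "\<tau> \<ge> 0"
  shows "(LINT x|lborel. F (complex_of_real x) * complex_of_real (sinc_kernel \<tau> (t - x))) = F (complex_of_real t)"
proof -
  note F' = paley_wienerD[OF F]
  note [measurable] = F'(3)
  define G where "G = (\<lambda>z. F (complex_of_real t + z))"
  have "G 0 = (LINT x|lborel. G (complex_of_real x) * complex_of_real (sinc_kernel \<tau> x))"
  proof (rule reproducing_formula_at_0[OF _ _ \<tau>])
    show "G holomorphic_on UNIV"
      unfolding G_def by (intro holomorphic_on_compose_gen[OF _ F'(1), unfolded o_def] holomorphic_intros) auto
    show "exponential_type_le G \<tau>"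
      unfolding exponential_type_le_def
    proof (intro allI impI)
      fix \<epsilon> :: real assume \<epsilon>: "\<epsilon> > 0"
      then obtain A where A: "\<And>z. norm (F z) \<le> A * exp ((\<tau> + \<epsilon>) * norm z)"
        using F'(2) by (auto simp: exponential_type_le_def)
      have "A \<ge> 0"
        using A[of 0] by (simp add: order_trans[OF norm_ge_zero])
      have "norm (G z) \<le> A * exp ((\<tau> + \<epsilon>) * \<bar>t\<bar>) * exp ((\<tau> + \<epsilon>) * norm z)" for z
      proof -
        have "norm (G z) \<le> A * exp ((\<tau> + \<epsilon>) * norm (complex_of_real t + z))"
          unfolding G_def by (rule A)
        also have "\<dots> \<le> A * exp ((\<tau> + \<epsilon>) * (\<bar>t\<bar> + norm z))"
          using \<open>A \<ge> 0\<close> \<tau> \<epsilon> norm_triangle_ineq[of "complex_of_real t" z]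
          by (intro mult_left_mono exp_mono) auto
        finally show ?thesis
          by (simp add: exp_add distrib_left)
      qed
      then show "\<exists>A. \<forall>z. norm (G z) \<le> A * exp ((\<tau> + \<epsilon>) * norm z)"
        by blast
    qed
    show "integrable lborel (\<lambda>x. (norm (G (complex_of_real x)))\<^sup>2)"
      using lborel_integrable_real_affine[OF F'(4), of 1 t] by (simp add: G_def)
  qed
  also have "\<dots> = (LINT x|lborel. F (complex_of_real x) * complex_of_real (sinc_kernel \<tau> (x - t)))"
    using lborel_integral_real_affine[of 1 "\<lambda>x. F (complex_of_real x) * complex_of_real (sinc_kernel \<tau> (x - t))" t]
    by (simp add: G_def)
  also have "\<dots> = (LINT x|lborel. F (complex_of_real x) * complex_of_real (sinc_kernel \<tau> (t - x)))"
    using sinc_kernel_minus[of \<tau> "t - x" for x] by simp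
  finally show ?thesis
    by (simp add: G_def)
qed

section \<open>Averages of dilations\<close>

text \<open>Since \<open>\<Phi>\<close> lives on \<open>u \<ge> 1\<close>, the points \<open>z / u\<close> that matter lie in the disc of radius \<open>\<bar>z\<bar>\<close>.\<close>

lemma integrable_dilation_integrand:
  fixes M :: "real measure" and \<Phi> :: "real \<Rightarrow> complex" and F :: "complex \<Rightarrow> complex"
  assumes id: "(\<lambda>u. u) \<in> borel_measurable M" and \<Phi>: "integrable M \<Phi>"
    and supp: "AE u in M. \<Phi> u \<noteq> 0 \<longrightarrow> 1 \<le> u"
    and F: "continuous_on UNIV F"
    and bound: "\<And>w. norm w \<le> norm z \<Longrightarrow> norm (F w) \<le> B"
  shows "integrable M (\<lambda>u. \<Phi> u * F (z / complex_of_real u))"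
    and "(LINT u|M. norm (\<Phi> u * F (z / complex_of_real u))) \<le> B * (LINT u|M. norm (\<Phi> u))"
proof -
  note [measurable] = id borel_measurable_integrable[OF \<Phi>] borel_measurable_continuous_onI[OF F]
  have le: "norm (\<Phi> u * F (z / complex_of_real u)) \<le> B * norm (\<Phi> u)" if "\<Phi> u \<noteq> 0 \<longrightarrow> 1 \<le> u" for u
  proof (cases "\<Phi> u = 0")
    case False
    with that have "1 \<le> u"
      by simp
    then have "norm z / u \<le> norm z / 1"
      by (intro divide_left_mono) auto
    with \<open>1 \<le> u\<close> have "norm (z / complex_of_real u) \<le> norm z"
      by (simp add: norm_divide)
    then have "norm (F (z / complex_of_real u)) * norm (\<Phi> u) \<le> B * norm (\<Phi> u)"
      by (intro mult_right_mono bound) auto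
    then show ?thesis
      by (simp add: norm_mult mult.commute)
  qed auto
  have int_bound: "integrable M (\<lambda>u. B * norm (\<Phi> u))"
    using \<Phi> by simp
  have AE_le: "AE u in M. norm (\<Phi> u * F (z / complex_of_real u)) \<le> B * norm (\<Phi> u)"
    using supp by eventually_elim (rule le)
  show int: "integrable M (\<lambda>u. \<Phi> u * F (z / complex_of_real u))"
    using AE_le by (intro Bochner_Integration.integrable_bound[OF int_bound])
      (auto elim!: eventually_mono intro: order_trans[OF _ abs_ge_self])
  have "(LINT u|M. norm (\<Phi> u * F (z / complex_of_real u))) \<le> (LINT u|M. B * norm (\<Phi> u))"
    by (intro integral_mono_AE integrable_norm[OF int] int_bound AE_le)
  then show "(LINT u|M. norm (\<Phi> u * F (z / complex_of_real u))) \<le> B * (LINT u|M. norm (\<Phi> u))"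
    by simp
qed

text \<open>Integrating the Taylor series of \<open>F\<close> at 0 term by term multiplies its \<open>n\<close>-th coefficient by the moment
\<open>\<integral> \<Phi> u / u\<^sup>n\<close>. As \<open>\<Phi>\<close> lives on \<open>u \<ge> 1\<close>, the moments are bounded by its \<open>L1\<close> norm, so the new series converges
everywhere too.\<close>

lemma holomorphic_dilation_average:
  fixes M :: "real measure" and \<Phi> :: "real \<Rightarrow> complex" and F :: "complex \<Rightarrow> complex"
  assumes id: "(\<lambda>u. u) \<in> borel_measurable M" and \<Phi>: "integrable M \<Phi>"
    and supp: "AE u in M. \<Phi> u \<noteq> 0 \<longrightarrow> 1 \<le> u"
    and hol: "F holomorphic_on UNIV"
  shows "(\<lambda>z. LINT u|M. \<Phi> u * F (z / complex_of_real u)) holomorphic_on UNIV"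
proof -
  define a where "a = (\<lambda>n. (deriv ^^ n) F 0 / fact n)"
  define m where "m = (\<lambda>n. LINT u|M. \<Phi> u * (1 / complex_of_real u) ^ n)"
  have F_sums: "(\<lambda>n. a n * w ^ n) sums F w" for w
    using holomorphic_power_series[of F 0 "norm w + 1" w] hol
    by (auto simp: a_def intro: holomorphic_on_subset)
  have abs_summable: "summable (\<lambda>n. norm (a n * w ^ n))" for w
    using powser_insidea[of a "of_real (norm w + 1)" w] sums_summable[OF F_sums] by simp
  have sums: "(\<lambda>n. a n * m n * z ^ n) sums (LINT u|M. \<Phi> u * F (z / complex_of_real u))" for z
  proof -
    define f where "f = (\<lambda>n u. \<Phi> u * (a n * (z / complex_of_real u) ^ n))"
    have f: "integrable M (f n)"
      "(LINT u|M. norm (f n u)) \<le> norm (a n * z ^ n) * (LINT u|M. norm (\<Phi> u))" for n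
    proof -
      have "norm (a n * w ^ n) \<le> norm (a n * z ^ n)" if "norm w \<le> norm z" for w
        using that by (simp add: norm_mult norm_power mult_left_mono power_mono)
      note * = integrable_dilation_integrand[OF id \<Phi> supp _ this, of "\<lambda>w. w"]
      show "integrable M (f n)" "(LINT u|M. norm (f n u)) \<le> norm (a n * z ^ n) * (LINT u|M. norm (\<Phi> u))"
        unfolding f_def by (intro * continuous_intros; simp)+
    qed
    have "(\<lambda>n. integral\<^sup>L M (f n)) sums (LINT u|M. (\<Sum>n. f n u))"
    proof (rule sums_integral[OF f(1)])
      show "AE u in M. summable (\<lambda>n. norm (f n u))"
        unfolding f_def norm_mult[of "\<Phi> _"] by (intro AE_I2 summable_mult abs_summable)
      show "summable (\<lambda>n. LINT u|M. norm (f n u))"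
        by (rule summable_comparison_test'[OF summable_mult2[OF abs_summable[of z]]])
          (use f(2) in auto)
    qed
    moreover have "(\<Sum>n. f n u) = \<Phi> u * F (z / complex_of_real u)" for u
      unfolding f_def by (intro sums_unique[symmetric] sums_mult F_sums)
    moreover have "integral\<^sup>L M (f n) = a n * m n * z ^ n" for n
    proof -
      have "integral\<^sup>L M (f n) = (LINT u|M. (a n * z ^ n) * (\<Phi> u * (1 / complex_of_real u) ^ n))"
        unfolding f_def by (intro Bochner_Integration.integral_cong) (auto simp: power_divide)
      then show ?thesis
        by (simp add: m_def)
    qed
    ultimately show ?thesis
      by simp
  qed
  have "(\<lambda>z. LINT u|M. \<Phi> u * F (z / complex_of_real u)) holomorphic_on ball 0 r" for r
    by (rule power_series_holomorphic[where a = "\<lambda>n. a n * m n"]) (use sums in simp)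
  then have "(\<lambda>z. LINT u|M. \<Phi> u * F (z / complex_of_real u)) field_differentiable at z" for z
    by (rule holomorphic_on_imp_differentiable_at[of _ "ball 0 (norm z + 1)"]) auto
  then show ?thesis
    by (simp add: holomorphic_on_def field_differentiable_at_within)
qed

lemma exponential_type_dilation_average:
  fixes M :: "real measure" and \<Phi> :: "real \<Rightarrow> complex" and F :: "complex \<Rightarrow> complex"
  assumes id: "(\<lambda>u. u) \<in> borel_measurable M" and \<Phi>: "integrable M \<Phi>"
    and supp: "AE u in M. \<Phi> u \<noteq> 0 \<longrightarrow> 1 \<le> u"
    and F: "continuous_on UNIV F" "exponential_type_le F \<tau>" and \<tau>: "\<tau> \<ge> 0"
  shows "integrable M (\<lambda>u. \<Phi> u * F (z / complex_of_real u))"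
    and "exponential_type_le (\<lambda>z. LINT u|M. \<Phi> u * F (z / complex_of_real u)) \<tau>"
proof -
  have growth: "\<exists>A. \<forall>(z::complex) w. norm w \<le> norm z \<longrightarrow> norm (F w) \<le> A * exp ((\<tau> + \<epsilon>) * norm z)" if \<epsilon>: "\<epsilon> > 0" for \<epsilon>
  proof -
    obtain A where A: "\<And>z. norm (F z) \<le> A * exp ((\<tau> + \<epsilon>) * norm z)"
      using F(2) \<epsilon> by (auto simp: exponential_type_le_def)
    have "A \<ge> 0"
      using A[of 0] by (simp add: order_trans[OF norm_ge_zero])
    have "norm (F w) \<le> A * exp ((\<tau> + \<epsilon>) * norm z)" if "norm w \<le> norm z" for z w :: complex
    proof -
      have "A * exp ((\<tau> + \<epsilon>) * norm w) \<le> A * exp ((\<tau> + \<epsilon>) * norm z)"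
        using that \<open>A \<ge> 0\<close> \<tau> \<epsilon> by (intro mult_left_mono exp_mono) auto
      then show ?thesis
        using A[of w] by linarith
    qed
    then show ?thesis
      by blast
  qed
  show "integrable M (\<lambda>u. \<Phi> u * F (z / complex_of_real u))"
    using growth[of 1] integrable_dilation_integrand(1)[OF id \<Phi> supp F(1)] by (metis zero_less_one)
  show "exponential_type_le (\<lambda>z. LINT u|M. \<Phi> u * F (z / complex_of_real u)) \<tau>"
    unfolding exponential_type_le_def
  proof (intro allI impI)
    fix \<epsilon> :: real assume "\<epsilon> > 0"
    then obtain A where A: "\<And>(z::complex) w. norm w \<le> norm z \<Longrightarrow> norm (F w) \<le> A * exp ((\<tau> + \<epsilon>) * norm z)"
      using growth by blast
    have "norm (LINT u|M. \<Phi> u * F (z / complex_of_real u))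
        \<le> (A * (LINT u|M. norm (\<Phi> u))) * exp ((\<tau> + \<epsilon>) * norm z)" for z
      using order_trans[OF integral_norm_bound integrable_dilation_integrand(2)[OF id \<Phi> supp F(1) A[of _ z]]]
      by (simp add: mult_ac)
    then show "\<exists>A. \<forall>z. norm (LINT u|M. \<Phi> u * F (z / complex_of_real u)) \<le> A * exp ((\<tau> + \<epsilon>) * norm z)"
      by blast
  qed
qed

text \<open>Insert the reproducing formula for \<open>F (t / u)\<close> and exchange the integrals. Fubini's theorem needs a
sigma-finite measure, which \<open>M\<close> may fail to be; so \<open>\<Phi> dM\<close> is written as \<open>s dN\<close> with the
finite measure \<open>dN = \<bar>\<Phi>\<bar> dM\<close> and \<open>s = sgn \<Phi>\<close>. The inner integrals are bounded uniformly in \<open>u\<close> because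
all translates of the kernel have the same \<open>L2\<close> norm.\<close>

lemma dilation_average_eq_integral_operator:
  fixes M :: "real measure" and \<Phi> :: "real \<Rightarrow> complex" and F :: "complex \<Rightarrow> complex"
  assumes id: "(\<lambda>u. u) \<in> borel_measurable M" and \<Phi>: "integrable M \<Phi>"
    and F: "F \<in> paley_wiener \<tau>" and \<tau>: "\<tau> \<ge> 0"
  shows "(LINT u|M. \<Phi> u * F (complex_of_real t / complex_of_real u))
       = (LINT x|lebesgue. (LINT u|M. \<Phi> u * complex_of_real (sinc_kernel \<tau> (t / u - x))) * F (complex_of_real x))"
proof -
  note F' = paley_wienerD[OF F]
  define N where "N = density M (\<lambda>u. norm (\<Phi> u))"
  define s where "s = (\<lambda>u. sgn (\<Phi> u))"
  define j where "j = (\<lambda>u::real. t / u)"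
  define f where "f = (\<lambda>u x. s u * (F (complex_of_real x) * complex_of_real (sinc_kernel \<tau> (j u - x))))"
  note \<Phi>_meas [measurable] = borel_measurable_integrable[OF \<Phi>]
  have [measurable]: "s \<in> borel_measurable M" "j \<in> borel_measurable M"
    using id by (auto simp: s_def j_def sgn_div_norm)
  then have [measurable]: "s \<in> borel_measurable N" "j \<in> borel_measurable N"
    by (auto simp: N_def)
  note [measurable] = F'(3)
  have density: "(LINT u|N. s u * g u) = (LINT u|M. \<Phi> u * g u)"
    if [measurable]: "g \<in> borel_measurable M" for g :: "real \<Rightarrow> complex"
  proof -
    have "(LINT u|N. s u * g u) = (LINT u|M. norm (\<Phi> u) *\<^sub>R (s u * g u))"
      unfolding N_def by (rule integral_density) auto
    also have "\<dots> = (LINT u|M. \<Phi> u * g u)"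
    proof (intro Bochner_Integration.integral_cong refl)
      show "norm (\<Phi> u) *\<^sub>R (s u * g u) = \<Phi> u * g u" for u
        by (cases "\<Phi> u = 0") (auto simp: s_def sgn_div_norm)
    qed
    finally show ?thesis .
  qed
  have "emeasure N (space N) = (\<integral>\<^sup>+u. ennreal (norm (\<Phi> u)) \<partial>M)"
    by (simp add: N_def emeasure_density cong: nn_integral_cong)
  also have "\<dots> < \<infinity>"
    using \<Phi> by (simp add: integrable_iff_bounded)
  finally interpret N: finite_measure N
    by (intro finite_measureI) simp
  interpret NL: pair_sigma_finite N lborel ..
  have f_meas [measurable]: "case_prod f \<in> borel_measurable (N \<Otimes>\<^sub>M lborel)"
    unfolding f_def by measurable
  have int_f: "integrable lborel (f u)" for u
    unfolding f_def by (intro integrable_mult_right integrable_mult_sinc_kernel F')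
  have norm_s: "norm (s u) \<le> 1" for u
    by (simp add: s_def norm_sgn)
  have norm_f_le: "(LINT x|lborel. norm (f u x))
      \<le> (LINT x|lborel. (norm (F (complex_of_real x)))\<^sup>2) + (LINT x|lborel. (sinc_kernel \<tau> x)\<^sup>2)" for u
  proof -
    have "(LINT x|lborel. norm (f u x))
        \<le> (LINT x|lborel. norm (F (complex_of_real x) * complex_of_real (sinc_kernel \<tau> (j u - x))))"
    proof (rule integral_mono)
      show "norm (f u x) \<le> norm (F (complex_of_real x) * complex_of_real (sinc_kernel \<tau> (j u - x)))" for x
        unfolding f_def norm_mult[of "s u"] by (rule mult_left_le_one_le) (use norm_s in auto)
    qed (intro integrable_norm int_f integrable_mult_sinc_kernel F')+
    also note integrable_mult_sinc_kernel(2)[OF F'(3,4)]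
    finally show ?thesis .
  qed
  have int: "integrable (N \<Otimes>\<^sub>M lborel) (case_prod f)"
  proof (rule NL.Fubini_integrable)
    show "integrable N (\<lambda>u. LINT x|lborel. norm (case_prod f (u, x)))"
      by (rule N.integrable_const_bound[of _ "(LINT x|lborel. (norm (F (complex_of_real x)))\<^sup>2) + (LINT x|lborel. (sinc_kernel \<tau> x)\<^sup>2)"])
        (use norm_f_le in auto)
  qed (use int_f in auto)
  have inner_u: "(LINT x|lborel. f u x) = s u * F (complex_of_real (j u))" for u
    unfolding f_def by (simp add: paley_wiener_reproducing_formula[OF F \<tau>])
  have inner_x: "(LINT u|N. f u x) = (LINT u|M. \<Phi> u * complex_of_real (sinc_kernel \<tau> (t / u - x))) * F (complex_of_real x)" for x
  proof -
    have "(LINT u|N. f u x) = (LINT u|M. \<Phi> u * (F (complex_of_real x) * complex_of_real (sinc_kernel \<tau> (j u - x))))"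
      unfolding f_def by (rule density) simp
    also have "\<dots> = (LINT u|M. F (complex_of_real x) * (\<Phi> u * complex_of_real (sinc_kernel \<tau> (t / u - x))))"
      by (simp add: j_def mult_ac)
    finally show ?thesis
      by (simp add: mult.commute)
  qed
  have "(\<lambda>u. F (complex_of_real (j u))) \<in> borel_measurable M"
    by measurable
  from density[OF this]
  have "(LINT u|M. \<Phi> u * F (complex_of_real t / complex_of_real u)) = (LINT u|N. s u * F (complex_of_real (j u)))"
    by (simp add: j_def)
  also have "\<dots> = (LINT u|N. LINT x|lborel. f u x)"
    by (simp add: inner_u)
  also have "\<dots> = (LINT x|lborel. LINT u|N. f u x)"
    by (rule NL.Fubini_integral[OF int, symmetric])
  also have "\<dots> = (LINT x|lebesgue. LINT u|N. f u x)"
  proof (rule integral_completion[symmetric])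
    show "(\<lambda>x. LINT u|N. f u x) \<in> borel_measurable lborel"
      by measurable
  qed
  finally show ?thesis
    by (simp add: inner_x)
qed

theorem corollary19:
  fixes \<mu> :: "real measure" and \<Phi> :: "real \<Rightarrow> complex"
  assumes "regular_borel_measure_on {0<..} \<mu>"
    and "\<Phi> \<in> borel_measurable (completion \<mu>)"
    and "integrable (completion \<mu>) \<Phi>"
    and "AE u in \<mu>. u \<in> {0<..<1} \<longrightarrow> \<Phi> u = 0"
    and "kernel_operator_bounded_in_L2 \<Phi> \<mu>"
  shows "hausdorff_bounded_in_PW \<Phi> \<mu>"
proof -
  have sets: "sets \<mu> = sets (restrict_space borel {0<..})"
    using assms(1) by (simp add: regular_borel_measure_on_def)
  then have "(\<lambda>u. u) \<in> borel_measurable \<mu>"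
    by (subst measurable_cong_sets[OF _ refl]) (auto intro: measurable_restrict_space1)
  then have id: "(\<lambda>u. u) \<in> borel_measurable (completion \<mu>)"
    by (rule measurable_completion)
  have space: "space \<mu> = {0<..}"
    using sets_eq_imp_space_eq[OF sets] by (simp add: space_restrict_space)
  have supp: "AE u in completion \<mu>. \<Phi> u \<noteq> 0 \<longrightarrow> 1 \<le> u"
    using AE_completion[OF assms(4)] AE_space[of "completion \<mu>"]
    by eventually_elim (auto simp: space not_less)
  note \<Phi> = assms(3)
  define H where "H = hausdorff_operator \<Phi> \<mu>"
  define K where "K = integral_operator (hausdorff_kernel \<Phi> \<mu>)"
  have H_eq: "H F = (\<lambda>z. LINT u|completion \<mu>. \<Phi> u * F (z / complex_of_real u))" for F
    by (auto simp: H_def hausdorff_operator_def hausdorff_integrand_def)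
  have HK: "H F (complex_of_real t) = K (\<lambda>t. F (complex_of_real t)) t" if "F \<in> paley_wiener pi" for F t
    using dilation_average_eq_integral_operator[OF id \<Phi> that]
    by (simp add: H_eq K_def integral_operator_def hausdorff_kernel_def normalized_sinc_of_real
        del: of_real_divide of_real_diff)
  have real_L2: "(\<lambda>t. F (complex_of_real t)) \<in> L2" if "F \<in> paley_wiener pi" for F
    using that by (simp add: paley_wiener_def)
  obtain C where K: "\<And>f. f \<in> L2 \<Longrightarrow> K f \<in> L2" "\<And>f. f \<in> L2 \<Longrightarrow> L2_norm (K f) \<le> C * L2_norm f"
    using assms(5) by (auto simp: kernel_operator_bounded_in_L2_def bounded_operator_in_def K_def)
  have type: "integrable (completion \<mu>) (hausdorff_integrand \<Phi> F z)" "exponential_type_le (H F) pi"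
    if "F \<in> paley_wiener pi" for F z
    using exponential_type_dilation_average[OF id \<Phi> supp _ paley_wienerD(2)[OF that]]
      holomorphic_on_imp_continuous_on[OF paley_wienerD(1)[OF that]]
    by (auto simp: H_eq hausdorff_integrand_def[abs_def])
  have "H F \<in> paley_wiener pi" if "F \<in> paley_wiener pi" for F
    using holomorphic_dilation_average[OF id \<Phi> supp paley_wienerD(1)[OF that]] type(2)[OF that]
      K(1)[OF real_L2[OF that]]
    by (simp add: paley_wiener_def HK[OF that]) (simp add: H_eq)
  moreover have "PW_norm (H F) \<le> C * PW_norm F" if "F \<in> paley_wiener pi" for F
    using K(2)[OF real_L2[OF that]] by (simp add: PW_norm_def HK[OF that])
  ultimately show ?thesis
    using type(1) unfolding hausdorff_bounded_in_PW_def bounded_operator_in_def H_def by blast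
qed

end
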